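(* (Strong completeness.) Let $\Gamma$ be a finite sequent and $A$ a term. If $\Gamma \vDash A$ then $\Gamma \vdash_{\mathbb{T}} A$.
   Context: Fix a countable set $\Phi$ of atomic propositions. Terms are generated from the elements of $\Phi$ and a constant $\mathbb{1}$ using a binary connective $\otimes$ (with parentheses). A sequent is a (possibly empty) multiset of terms; a comma denotes multiset union. The system $\mathbb{T}$ has the following deduction rules. (Id) $P \vdash P$ for every atomic proposition $P\in\Phi$. (Cut) From $\Gamma \vdash B$ and $\Delta, B \vdash A$ deduce $\Delta,\Gamma \vdash A$, for any term $B$. (L-$\mathbb{1}$) From $\Gamma \vdash A$ deduce $\Gamma, \mathbb{1} \vdash A$. (R-$\mathbb{1}$) $\vdash \mathbb{1}$. (L-$\otimes$) From $A, B, \Gamma \vdash C$ deduce $A\otimes B, \Gamma \vdash C$. (R-$\otimes$) From $\Gamma \vdash A$ and $\Delta \vdash B$ deduce $\Gamma,\Delta \vdash A\otimes B$. (Exchange) Antecedent terms may be reordered arbitrarily (automatic when antecedents are multisets). $\Gamma\vdash_{\mathbb{T}} A$ means that $\Gamma\vdash A$ is the conclusion of a finite tree of rule applications. An ordered commutative monoid $(\mathbb{M},\cdot,e,\le)$ is a commutative monoid with a preorder $\le$ such that $r\le s$ and $x\le y$ imply $r\cdot x\le s\cdot y$. An algebraic model $\mathcal{M}$ of $\mathbb{T}$ consists of an ordered commutative monoid $(\mathbb{M},\cdot,e,\le)$ and a function $v:\Phi\to\mathbb{M}$. The forcing relation $m\Vdash A$ ($m\in\mathbb{M}$, $A$ a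 term) is defined inductively by: $m\Vdash P$ iff $m\le v(P)$ for $P\in\Phi$; $m\Vdash A\otimes B$ iff there exist $n_1,n_2\in\mathbb{M}$ with $m=n_1\cdot n_2$, $n_1\Vdash A$ and $n_2\Vdash B$; $m\Vdash\mathbb{1}$ iff $m=e$. For a finite sequent $A_1,\dots,A_k$ and $m\in\mathbb{M}$, $\mathcal{M}: A_1,\dots,A_k\vDash_m B$ means: if there exist $m_1,\dots,m_k$ with $m=m_1\cdots m_k$ and $m_j\Vdash A_j$ for each $j$, then $m\Vdash B$ (for $k=0$: $m\Vdash B$ or $m\ne e$). $\mathcal{M}:\Gamma\vDash B$ means $\mathcal{M}:\Gamma\vDash_m B$ for all $m\in\mathbb{M}$, and $\Gamma\vDash B$ means $\mathcal{M}:\Gamma\vDash B$ for all models $\mathcal{M}$. *)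

theory Defs
  imports
    "HOL-Library.Multiset"
    "HOL-Library.Countable_Set"
    "HOL-Library.Infinite_Typeclass"
    "HOL-Algebra.FiniteProduct"
begin

datatype (atoms: 'p) trm =
    Atom 'p
  | Unit
  | Tensor "'p trm" "'p trm"  (infixr \<open>\<otimes>\<^sub>T\<close> 75)

definition terms :: "'p set \<Rightarrow> 'p trm set" where
  "terms \<Phi> = {A. atoms A \<subseteq> \<Phi>}"

(* Exchange is built in, since antecedents are multisets. Only Id mentions \<Phi>: every other
   rule preserves the property that all terms of a derivable sequent, hence also all cut
   terms, lie in terms \<Phi>. *)
inductive derives :: "'p set \<Rightarrow> 'p trm multiset \<Rightarrow> 'p trm \<Rightarrow> bool"
  for \<Phi> :: "'p set" where
  Id: "P \<in> \<Phi> \<Longrightarrow> derives \<Phi> {#Atom P#} (Atom P)"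
| Cut: "derives \<Phi> \<Gamma> B \<Longrightarrow> derives \<Phi> (\<Delta> + {#B#}) A \<Longrightarrow> derives \<Phi> (\<Delta> + \<Gamma>) A"
| L_Unit: "derives \<Phi> \<Gamma> A \<Longrightarrow> derives \<Phi> (\<Gamma> + {#Unit#}) A"
| R_Unit: "derives \<Phi> {#} Unit"
| L_Tensor: "derives \<Phi> ({#A#} + {#B#} + \<Gamma>) C \<Longrightarrow> derives \<Phi> ({#A \<otimes>\<^sub>T B#} + \<Gamma>) C"
| R_Tensor: "derives \<Phi> \<Gamma> A \<Longrightarrow> derives \<Phi> \<Delta> B \<Longrightarrow> derives \<Phi> (\<Gamma> + \<Delta>) (A \<otimes>\<^sub>T B)"

(* le is an arbitrary preorder on the carrier; antisymmetry is not required. *)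
record 'm ordered_monoid = "'m monoid" +
  le :: "('m \<times> 'm) set"

locale ordered_comm_monoid = comm_monoid M for M :: "('m, 'b) ordered_monoid_scheme" (structure) +
  assumes le_preorder: "preorder_on (carrier M) (le M)"
    and mult_mono: "\<lbrakk>(r, s) \<in> le M; (x, y) \<in> le M\<rbrakk> \<Longrightarrow> (r \<otimes> x, s \<otimes> y) \<in> le M"

locale algebraic_model = ordered_comm_monoid M
  for \<Phi> :: "'p set" and M :: "('m, 'b) ordered_monoid_scheme" (structure) and v :: "'p \<Rightarrow> 'm" +
  assumes valuation: "v \<in> \<Phi> \<rightarrow> carrier M"

primrec forces :: "('m, 'b) ordered_monoid_scheme \<Rightarrow> ('p \<Rightarrow> 'm) \<Rightarrow> 'm \<Rightarrow> 'p trm \<Rightarrow> bool" where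
  "forces M v m (Atom P) \<longleftrightarrow> (m, v P) \<in> le M"
| "forces M v m Unit \<longleftrightarrow> m = \<one>\<^bsub>M\<^esub>"
| "forces M v m (A \<otimes>\<^sub>T B) \<longleftrightarrow>
     (\<exists>n\<^sub>1 \<in> carrier M. \<exists>n\<^sub>2 \<in> carrier M.
        m = n\<^sub>1 \<otimes>\<^bsub>M\<^esub> n\<^sub>2 \<and> forces M v n\<^sub>1 A \<and> forces M v n\<^sub>2 B)"

(* As enumerates the multiset \<Gamma>; since M is commutative the enumeration is immaterial.
   The product over the empty index set is \<one>, so for empty \<Gamma> this reads m = \<one> \<longrightarrow> m forces B. *)
definition valid_at ::
  "('m, 'b) ordered_monoid_scheme \<Rightarrow> ('p \<Rightarrow> 'm) \<Rightarrow> 'm \<Rightarrow> 'p trm multiset \<Rightarrow> 'p trm \<Rightarrow> bool" where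
  "valid_at M v m \<Gamma> B \<longleftrightarrow>
     ((\<exists>As n. mset As = \<Gamma> \<and> n \<in> {..<length As} \<rightarrow> carrier M \<and>
        m = (\<Otimes>\<^bsub>M\<^esub>j\<in>{..<length As}. n j) \<and>
        (\<forall>j<length As. forces M v (n j) (As ! j)))
      \<longrightarrow> forces M v m B)"

definition valid_in ::
  "('m, 'b) ordered_monoid_scheme \<Rightarrow> ('p \<Rightarrow> 'm) \<Rightarrow> 'p trm multiset \<Rightarrow> 'p trm \<Rightarrow> bool" where
  "valid_in M v \<Gamma> B \<longleftrightarrow> (\<forall>m \<in> carrier M. valid_at M v m \<Gamma> B)"

(* HOL cannot quantify over all types inside a formula, so the models range over those whose
   carrier is an arbitrary subset of the type 'm. *)
definition entails :: "'m itself \<Rightarrow> 'p set \<Rightarrow> 'p trm multiset \<Rightarrow> 'p trm \<Rightarrow> bool" where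
  "entails _ \<Phi> \<Gamma> B \<longleftrightarrow>
     (\<forall>(M :: 'm ordered_monoid) v. algebraic_model \<Phi> M v \<longrightarrow> valid_in M v \<Gamma> B)"

end

theory Submission
  imports Defs
begin

text \<open>
  Send every term to the multiset of atoms occurring in it. In the free commutative monoid over the
  atoms, ordered by equality and with each atom valued at its own generator, an element forces a
  term iff it is the atom multiset of that term. So validity of a sequent in this single model
  already means that antecedent and succedent have the same atoms with multiplicity, and every such
  sequent is derivable, even without cut. The hypotheses on cardinality only serve to copy this
  monoid into the given type.
\<close>

primrec atom_mset :: "'p trm \<Rightarrow> 'p multiset" where
  "atom_mset (Atom P) = {#P#}"
| "atom_mset Unit = {#}"
| "atom_mset (A \<otimes>\<^sub>T B) = atom_mset A + atom_mset B"

lemma set_mset_atom_mset [simp]: "set_mset (atom_mset A) = atoms A"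
  by (induction A) auto

abbreviation atoms_of_seq :: "'p trm multiset \<Rightarrow> 'p multiset" where
  "atoms_of_seq \<Gamma> \<equiv> (\<Sum>A\<in>#\<Gamma>. atom_mset A)"

text \<open>The right rules build \<open>A\<close> along its syntax, starting from \<open>Id\<close>
  at each occurrence of an atom; \<open>A \<in> terms \<Phi>\<close> licenses these uses of
  \<open>Id\<close>.\<close>

lemma derives_from_atoms:
  assumes "A \<in> terms \<Phi>"
  shows "derives \<Phi> (image_mset Atom (atom_mset A)) A"
  using assms
  by (induction A) (auto simp: terms_def intro: derives.Id derives.R_Unit derives.R_Tensor)

text \<open>The left rules reassemble \<open>B\<close> inside the antecedent, whatever the succedent
  is.\<close>

lemma derives_fold_atoms:
  assumes "derives \<Phi> (image_mset Atom (atom_mset B) + \<Delta>) C"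
  shows "derives \<Phi> (add_mset B \<Delta>) C"
  using assms
proof (induction B arbitrary: \<Delta>)
  case Unit
  then show ?case
    using L_Unit by fastforce
next
  case (Tensor A B)
  \<comment> \<open>The context must be arbitrary: the atoms of \<open>B\<close> wait in it while
    \<open>A\<close> is assembled, then \<open>A\<close> waits in it while \<open>B\<close>
    is.\<close>
  have "derives \<Phi> (image_mset Atom (atom_mset A) + (image_mset Atom (atom_mset B) + \<Delta>)) C"
    using Tensor.prems by (simp add: add.assoc)
  then have "derives \<Phi> (add_mset A (image_mset Atom (atom_mset B) + \<Delta>)) C"
    by (rule Tensor.IH(1))
  then have "derives \<Phi> (add_mset B (add_mset A \<Delta>)) C"
    by (intro Tensor.IH(2)) simp
  then show ?case
    using L_Tensor[of \<Phi> A B \<Delta> C] by (simp add: add_mset_commute)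
qed simp

lemma derives_fold_atoms_seq:
  assumes "derives \<Phi> (image_mset Atom (atoms_of_seq \<Gamma>) + \<Delta>) C"
  shows "derives \<Phi> (\<Gamma> + \<Delta>) C"
  using assms
proof (induction \<Gamma> arbitrary: \<Delta>)
  case (add B \<Gamma>)
  have "derives \<Phi> (image_mset Atom (atoms_of_seq \<Gamma>) + (image_mset Atom (atom_mset B) + \<Delta>)) C"
    using add.prems by (simp add: ac_simps)
  then have "derives \<Phi> (\<Gamma> + (image_mset Atom (atom_mset B) + \<Delta>)) C"
    by (rule add.IH)
  then have "derives \<Phi> (add_mset B (\<Gamma> + \<Delta>)) C"
    by (intro derives_fold_atoms) (simp add: ac_simps)
  then show ?case by simp
qed simp

lemma derives_if_same_atoms:
  assumes "A \<in> terms \<Phi>" and "atoms_of_seq \<Gamma> = atom_mset A"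
  shows "derives \<Phi> \<Gamma> A"
  using derives_fold_atoms_seq[of \<Phi> \<Gamma> "{#}" A] derives_from_atoms[OF assms(1)] assms(2) by simp

text \<open>Models in \<open>entails\<close> have their carrier inside \<open>'m\<close>, so the
  monoid is copied along \<open>g\<close>, which is meant to be injective. The order is equality, so
  that an atom is forced by its value alone.\<close>

definition transported_monoid :: "('a::comm_monoid_add \<Rightarrow> 'm) \<Rightarrow> 'm ordered_monoid" where
  "transported_monoid g =
     \<lparr>carrier = range g, mult = (\<lambda>x y. g (inv_into UNIV g x + inv_into UNIV g y)), one = g 0, le = Id_on (range g)\<rparr>"

lemma transported_monoid_simps [simp]:
  "carrier (transported_monoid g) = range g"
  "\<one>\<^bsub>transported_monoid g\<^esub> = g 0"
  "le (transported_monoid g) = Id_on (range g)"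
  by (simp_all add: transported_monoid_def)

lemma mult_transported_monoid [simp]:
  "inj g \<Longrightarrow> g a \<otimes>\<^bsub>transported_monoid g\<^esub> g b = g (a + b)"
  by (simp add: transported_monoid_def)

lemma ordered_comm_monoid_transported:
  assumes "inj g"
  shows "ordered_comm_monoid (transported_monoid g)"
proof -
  have "comm_monoid (transported_monoid g)"
    by (rule comm_monoidI) (auto simp: assms ac_simps)
  then show ?thesis
    by (auto simp: ordered_comm_monoid_def ordered_comm_monoid_axioms_def preorder_on_def
        refl_on_def trans_def assms)
qed

lemma finprod_transported_monoid:
  fixes k :: nat
  assumes "inj g"
  shows "(\<Otimes>\<^bsub>transported_monoid g\<^esub>j\<in>{..<k}. g (h j)) = g (\<Sum>j<k. h j)"
proof -
  interpret ordered_comm_monoid "transported_monoid g"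
    using assms by (rule ordered_comm_monoid_transported)
  show ?thesis
    by (induction k) (simp_all add: lessThan_Suc assms add.commute Pi_def)
qed

lemma forces_transported_monoid:
  assumes "inj g"
  shows "forces (transported_monoid g) (\<lambda>P. g {#f P#}) x A \<longleftrightarrow> x = g (image_mset f (atom_mset A))"
  by (induction A arbitrary: x) (auto simp: assms inj_eq[OF assms])

text \<open>Each term of \<open>\<Gamma>\<close> is forced by the copy of its own atom multiset. The
  product of these elements is the copy of their sum, so by validity it forces \<open>A\<close>, and
  only one element does that.\<close>

lemma valid_in_transported_monoid:
  assumes "inj g" and "valid_in (transported_monoid g) (\<lambda>P. g {#f P#}) \<Gamma> A"
  shows "image_mset f (atoms_of_seq \<Gamma>) = image_mset f (atom_mset A)"
proof -
  obtain As where As: "mset As = \<Gamma>"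
    using ex_mset by blast
  define h where "h j = image_mset f (atom_mset (As ! j))" for j
  have "(\<Sum>j<length As. h j) = (\<Sum>B\<leftarrow>As. image_mset f (atom_mset B))"
    by (simp add: h_def sum_list_sum_nth atLeast0LessThan)
  also have "\<dots> = image_mset f (\<Sum>B\<leftarrow>As. atom_mset B)"
    by (induction As) simp_all
  also have "\<dots> = image_mset f (atoms_of_seq \<Gamma>)"
    by (simp flip: As sum_mset_sum_list)
  finally have sum: "(\<Sum>j<length As. h j) = image_mset f (atoms_of_seq \<Gamma>)" .
  have "forces (transported_monoid g) (\<lambda>P. g {#f P#}) (g (image_mset f (atoms_of_seq \<Gamma>))) A"
    using assms(2) As unfolding valid_in_def valid_at_def
    by (auto simp: forces_transported_monoid[OF assms(1)] finprod_transported_monoid[OF assms(1)]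
        h_def sum intro!: exI[of _ As] exI[of _ "\<lambda>j. g (h j)"] simp flip: sum)
  then show ?thesis
    by (simp add: forces_transported_monoid[OF assms(1)] inj_eq[OF assms(1)])
qed

text \<open>On multisets supported in \<open>S\<close>, mapping with \<open>inv_into S f\<close>
  undoes mapping with \<open>f\<close>.\<close>

lemma image_mset_inj_on_eq:
  assumes "inj_on f S" and "set_mset M \<subseteq> S" and "set_mset N \<subseteq> S"
    and "image_mset f M = image_mset f N"
  shows "M = N"
proof -
  have "image_mset (inv_into S f) (image_mset f K) = K" if "set_mset K \<subseteq> S" for K
  proof -
    have "image_mset (inv_into S f) (image_mset f K) = image_mset id K"
      unfolding multiset.map_comp
      using that by (intro image_mset_cong) (auto simp: assms(1))
    then show ?thesis by simp
  qed
  then show ?thesis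
    using assms by metis
qed

text \<open>Choosing an enumeration of each multiset embeds multisets into lists over a countable
  type, hence into \<open>nat\<close>, and an infinite type contains a copy of
  \<open>nat\<close>.\<close>

lemma ex_inj_multiset_infinite: "\<exists>g :: 'a::countable multiset \<Rightarrow> 'm::infinite. inj g"
proof -
  obtain e :: "nat \<Rightarrow> 'm" where "inj e"
    using infinite_countable_subset[OF infinite_UNIV] by blast
  moreover have "inj (inv_into UNIV mset :: 'a multiset \<Rightarrow> 'a list)"
    using surj_mset by (rule surj_imp_inj_inv)
  ultimately have "inj (e \<circ> (to_nat \<circ> inv_into UNIV mset) :: 'a multiset \<Rightarrow> 'm)"
    by (intro inj_compose) simp_all
  then show ?thesis
    by blast
qed

theorem theorem20:
  fixes \<Phi> :: "'p set" and \<Gamma> :: "'p trm multiset" and A :: "'p trm"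
  assumes "countable \<Phi>"
    and "set_mset \<Gamma> \<subseteq> terms \<Phi>"
    and "A \<in> terms \<Phi>"
    and "entails TYPE('m::infinite) \<Phi> \<Gamma> A"
  shows "derives \<Phi> \<Gamma> A"
proof -
  \<comment> \<open>Countability is given for \<open>\<Phi>\<close> and not for the type
    \<open>'p\<close>. Renaming atoms to numbers makes the multisets range over a countable type,
    which embeds into \<open>'m\<close>.\<close>
  obtain f :: "'p \<Rightarrow> nat" where f: "inj_on f \<Phi>"
    using assms(1) by (auto simp: countable_def)
  obtain g :: "nat multiset \<Rightarrow> 'm" where g: "inj g"
    using ex_inj_multiset_infinite by blast
  have "algebraic_model \<Phi> (transported_monoid g) (\<lambda>P. g {#f P#})"
    using ordered_comm_monoid_transported[OF g]
    by (simp add: algebraic_model_def algebraic_model_axioms_def)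
  then have "image_mset f (atoms_of_seq \<Gamma>) = image_mset f (atom_mset A)"
    using assms(4) unfolding entails_def by (intro valid_in_transported_monoid[OF g]) blast
  moreover have "set_mset (atoms_of_seq \<Gamma>) \<subseteq> \<Phi>"
    using assms(2) by (auto simp: terms_def)
  moreover have "set_mset (atom_mset A) \<subseteq> \<Phi>"
    using assms(3) by (simp add: terms_def)
  ultimately have "atoms_of_seq \<Gamma> = atom_mset A"
    using image_mset_inj_on_eq[OF f] by blast
  with assms(3) show ?thesis
    by (rule derives_if_same_atoms)
qed

end
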